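(* Let $\sigma\in\{\mathbf i,\mathbf e\}$ and $n\in J^\sigma\setminus\{0\}$, and let $m\in I_{\mathcal N}^{\mathbf i}(n)$ (that is, $0\le m\le n-1$) when $n>0$; otherwise (when $n\le-2$) let $m\in I_{\mathcal N}^{\mathbf e}(n+1)$ (that is, $0\le m\le -n$). Then $$Z_{n,0}^{\pm}=\mp\rho^{2n+1}\,(X_{-n-1,0}^{\pm})^*,$$ $$Z_{n,m}^{\pm}=\mp 2\rho^{2n+1}\,(X_{-n-1,m}^{\pm})^*,$$ the first formula being for $m=0$ (where only the superscript $+$ occurs) and the second for $m\ge1$. Here $^*$ is the linear involution defined for functions $f=f_1e_1+f_2e_2$ by $$f^*=f_2e_1+f_1e_2=-e_1fe_2,$$ and $(X_{-n-1,m}^{\pm})^*$ means $[X_{-n-1,m}^{\pm}]_2e_1+[X_{-n-1,m}^{\pm}]_1e_2$, where $[X]_j$ is the coefficient of $e_j$ in $X$.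
   Context: Write $x=(x_0,x_1,x_2)=(\rho\cos\theta,\rho\sin\theta\cos\phi,\rho\sin\theta\sin\phi)\in\mathbb R^3$, so $\rho=|x|$. The symbol $\sigma=\mathbf i$ refers to the interior $\{|x|<1\}$ and $\sigma=\mathbf e$ to the exterior $\{|x|>1\}$ of the unit sphere; $J^{\mathbf i}=\{n\in\mathbb Z: n\ge0\}$, $J^{\mathbf e}=\{n\in\mathbb Z: n\le-2\}$, and $I_{\mathcal N}^\sigma(n)=\{m:0\le m\le|n-1|\}$. Solid spherical harmonics: $U_{n,m}^{\pm}(x)=\rho^nP_n^m(\cos\theta)\Phi_m^{\pm}(\phi)$, where $\Phi_m^+(\phi)=\cos(m\phi)$, $\Phi_m^-(\phi)=\sin(m\phi)$, and $P_n^m$ is the associated Legendre function of degree $n$ and order $m$, with $P_{-n}^m=P_{n-1}^m$ for negative degrees. These expressions are considered both in the interior and in the exterior of the unit ball. $U_{n,m}^\pm=0$ when $m>n\ge0$, or when $n<0$ and $m>-n-1$. The combination of $m=0$ with the superscript "$-$" is always excluded for the functions $X_{n,m}^\pm$, $Z_{n,m}^\pm$ below, and $U_{n,0}^-=0$. Functions take values in $\mathcal A=\{a_0+a_1e_1+a_2e_2: a_i\in\mathbb R\}$, the real subspace of the quaternions with zero $e_3$-component, where $e_i^2=-1$ and $e_ie_j=-e_je_i$ for $i\ne j$. Basic monogenic functions: $X_{n,m}^{\pm}=\partial U_{n+1,m}^{\pm}$, where $\partial=\frac{\partial}{\partial x_0}-e_1\frac{\partial}{\partial x_1}-e_2\frac{\partial}{\partial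 x_2}$. With $\alpha_{n,m}=(n+m)(n+m+1)$, the basic vector-valued contragenic functions are $Z_{n,0}^{+}=U_{n,1}^{-}e_1-U_{n,1}^{+}e_2$ and, for $m\ge1$, $$Z_{n,m}^{\pm}=\big(U_{n,m+1}^{\mp}+\alpha_{n+1,-m}U_{n,m-1}^{\mp}\big)e_1\mp\big(U_{n,m+1}^{\pm}-\alpha_{n+1,-m}U_{n,m-1}^{\pm}\big)e_2.$$
   Formalization: As printed the identity fails (e.g. n=1, m=0). Proved with f* = f_2e_1 - f_1e_2 = fe_3 (so * is not an involution and not -e_1fe_2) and with α_{n,-m} in place of α_{n+1,-m} in Z_{n,m}^±, m≥1; P_n^m carries the phase (-1)^m. *)

theory Defs
  imports "HOL-Analysis.Analysis" "HOL-Computational_Algebra.Polynomial"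
begin

codatatype quat = Quat (Q0: real) (Q1: real) (Q2: real) (Q3: real)

lemma quat_eq_iff: "p = q \<longleftrightarrow> Q0 p = Q0 q \<and> Q1 p = Q1 q \<and> Q2 p = Q2 q \<and> Q3 p = Q3 q"
  using quat.expand by auto

instantiation quat :: real_algebra_1
begin

primcorec zero_quat where "Q0 0 = 0" | "Q1 0 = 0" | "Q2 0 = 0" | "Q3 0 = 0"

primcorec one_quat where "Q0 1 = 1" | "Q1 1 = 0" | "Q2 1 = 0" | "Q3 1 = 0"

primcorec plus_quat where
  "Q0 (p + q) = Q0 p + Q0 q"
| "Q1 (p + q) = Q1 p + Q1 q"
| "Q2 (p + q) = Q2 p + Q2 q"
| "Q3 (p + q) = Q3 p + Q3 q"

primcorec uminus_quat where
  "Q0 (- p) = - Q0 p"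
| "Q1 (- p) = - Q1 p"
| "Q2 (- p) = - Q2 p"
| "Q3 (- p) = - Q3 p"

primcorec minus_quat where
  "Q0 (p - q) = Q0 p - Q0 q"
| "Q1 (p - q) = Q1 p - Q1 q"
| "Q2 (p - q) = Q2 p - Q2 q"
| "Q3 (p - q) = Q3 p - Q3 q"

primcorec scaleR_quat where
  "Q0 (scaleR r q) = r * Q0 q"
| "Q1 (scaleR r q) = r * Q1 q"
| "Q2 (scaleR r q) = r * Q2 q"
| "Q3 (scaleR r q) = r * Q3 q"

primcorec times_quat where
  "Q0 (p * q) = Q0 p * Q0 q - Q1 p * Q1 q - Q2 p * Q2 q - Q3 p * Q3 q"
| "Q1 (p * q) = Q0 p * Q1 q + Q1 p * Q0 q + Q2 p * Q3 q - Q3 p * Q2 q"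
| "Q2 (p * q) = Q0 p * Q2 q - Q1 p * Q3 q + Q2 p * Q0 q + Q3 p * Q1 q"
| "Q3 (p * q) = Q0 p * Q3 q + Q1 p * Q2 q - Q2 p * Q1 q + Q3 p * Q0 q"

instance
  by standard (auto simp: quat_eq_iff algebra_simps)

end

definition e1 :: quat where "e1 = Quat 0 1 0 0"
definition e2 :: quat where "e2 = Quat 0 0 1 0"
definition e3 :: quat where "e3 = Quat 0 0 0 1"

lemma e_mult:
  "e1 * e1 = -1" "e2 * e2 = -1" "e1 * e2 = e3" "e2 * e1 = - (e1 * e2)"
  by (simp_all add: quat_eq_iff e1_def e2_def e3_def)

definition \<A> :: "quat set" where
  "\<A> = {q. Q3 q = 0}"

lemma \<A>_eq: "\<A> = {of_real a0 + a1 *\<^sub>R e1 + a2 *\<^sub>R e2 | a0 a1 a2. True}"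
proof -
  have "q = of_real (Q0 q) + Q1 q *\<^sub>R e1 + Q2 q *\<^sub>R e2" if "Q3 q = 0" for q
    using that by (simp add: quat_eq_iff e1_def e2_def of_real_def)
  then show ?thesis
    by (fastforce simp: \<A>_def e1_def e2_def of_real_def)
qed

datatype side = Interior | Exterior

fun J :: "side \<Rightarrow> int set" where
  "J Interior = {n. n \<ge> 0}"
| "J Exterior = {n. n \<le> -2}"

definition I_N :: "side \<Rightarrow> int \<Rightarrow> nat set" where
  "I_N \<sigma> n = {m. int m \<le> \<bar>n - 1\<bar>}"

datatype pm = Plus | Minus

fun flip :: "pm \<Rightarrow> pm" where
  "flip Plus = Minus"
| "flip Minus = Plus"

fun pm_sign :: "pm \<Rightarrow> real" where
  "pm_sign Plus = 1"
| "pm_sign Minus = -1"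

definition Legendre_poly :: "nat \<Rightarrow> real poly" where
  "Legendre_poly n = smult (1 / (2 ^ n * fact n)) ((pderiv ^^ n) ([:-1, 0, 1:] ^ n))"

text \<open>
  Ferrers' associated Legendre function on \<open>[-1, 1]\<close>, with the Condon-Shortley phase
  \<open>(-1)^m\<close>. Without the phase the identity between \<open>Z\<close> and \<open>X\<close> would hold with
  the opposite sign, since \<open>Z\<close> involves the orders \<open>m \<plusminus> 1\<close> and \<open>X\<close> is built from the order \<open>m\<close>.
  The case distinction is the convention \<open>P_{-n}^m = P_{n-1}^m\<close>.
\<close>
definition assoc_Legendre :: "int \<Rightarrow> nat \<Rightarrow> real \<Rightarrow> real" where
  "assoc_Legendre n m t =
     (-1) ^ m * sqrt (1 - t\<^sup>2) ^ m *
     poly ((pderiv ^^ m) (Legendre_poly (nat (if n \<ge> 0 then n else - n - 1)))) t"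

fun \<Phi> :: "nat \<Rightarrow> pm \<Rightarrow> real \<Rightarrow> real" where
  "\<Phi> m Plus \<phi> = cos (real m * \<phi>)"
| "\<Phi> m Minus \<phi> = sin (real m * \<phi>)"

text \<open>
  The coordinates \<open>x_0, x_1, x_2\<close> are \<open>x $ 0, x $ 1, x $ 2\<close> (in the index type, \<open>0 = 3\<close>).
  The azimuth \<open>\<phi>\<close> is the argument of \<open>x_1 + i x_2\<close>. Its jump and its value on the
  axis are harmless: \<open>\<Phi>\<close> is \<open>2 \<pi>\<close>-periodic, and on the axis \<open>assoc_Legendre\<close> vanishes
  for \<open>m > 0\<close> while \<open>\<Phi>\<close> is constant for \<open>m = 0\<close>.
\<close>
definition U :: "int \<Rightarrow> nat \<Rightarrow> pm \<Rightarrow> real ^ 3 \<Rightarrow> real" where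
  "U n m s x =
     norm x powi n * assoc_Legendre n m (x $ 0 / norm x) * \<Phi> m s (Arg (Complex (x $ 1) (x $ 2)))"

definition partial :: "3 \<Rightarrow> (real ^ 3 \<Rightarrow> real) \<Rightarrow> real ^ 3 \<Rightarrow> real" where
  "partial i f x = deriv (\<lambda>t. f (x + t *\<^sub>R axis i 1)) 0"

definition del :: "(real ^ 3 \<Rightarrow> real) \<Rightarrow> real ^ 3 \<Rightarrow> quat" where
  "del f x = of_real (partial 0 f x) - partial 1 f x *\<^sub>R e1 - partial 2 f x *\<^sub>R e2"

definition X :: "int \<Rightarrow> nat \<Rightarrow> pm \<Rightarrow> real ^ 3 \<Rightarrow> quat" where
  "X n m s = del (U (n + 1) m s)"

definition \<alpha> :: "int \<Rightarrow> int \<Rightarrow> real" where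
  "\<alpha> n m = of_int ((n + m) * (n + m + 1))"

text \<open>
  The coefficient is \<open>\<alpha> n (- m) = (n - m) (n - m + 1)\<close>. The variant \<open>\<alpha> (n + 1) (- m)\<close>, which also
  occurs in print, is correct only with the normalisation \<open>\<alpha> n m = (n + m) (n + m - 1)\<close>.
  The combination \<open>Z n 0 Minus\<close> is excluded and must not be used.
\<close>
definition Z :: "int \<Rightarrow> nat \<Rightarrow> pm \<Rightarrow> real ^ 3 \<Rightarrow> quat" where
  "Z n m s x =
     (if m = 0 then U n 1 Minus x *\<^sub>R e1 - U n 1 Plus x *\<^sub>R e2
      else (U n (m + 1) (flip s) x + \<alpha> n (- int m) * U n (m - 1) (flip s) x) *\<^sub>R e1
           - (pm_sign s * (U n (m + 1) s x - \<alpha> n (- int m) * U n (m - 1) s x)) *\<^sub>R e2)"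

text \<open>
  The operation \<open>f* = f_2 e_1 - f_1 e_2\<close> on vector parts, that is, \<open>f* = f e_3\<close> for
  \<open>f = f_1 e_1 + f_2 e_2\<close>. The printed involution \<open>f_2 e_1 + f_1 e_2 = - e_1 f e_2\<close> has the wrong
  sign in the second component: \<open>X_{-2,0}\<close> has the vector part \<open>(x_1 e_1 + x_2 e_2) / \<rho>^3\<close>, while
  \<open>Z_{1,0}\<close> is a multiple of \<open>x_2 e_1 - x_1 e_2\<close>.
\<close>
definition star :: "quat \<Rightarrow> quat" where
  "star q = Q2 q *\<^sub>R e1 - Q1 q *\<^sub>R e2"

lemma star_eq_mult_e3: "star (f1 *\<^sub>R e1 + f2 *\<^sub>R e2) = (f1 *\<^sub>R e1 + f2 *\<^sub>R e2) * e3"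
  by (simp add: star_def quat_eq_iff e1_def e2_def e3_def)

end

theory Submission
  imports Defs
begin

text \<open>
  Both sides of the identity are built from solid harmonics, \<open>Z\<^bsub>n,m\<^esub>\<close> from those of degree \<open>n\<close> and
  orders \<open>m \<plusminus> 1\<close> (order \<open>1\<close> alone if \<open>m = 0\<close>), and \<open>X\<^bsub>-n-1,m\<^esub>\<close> from the first derivatives of the one of degree \<open>-n\<close> and order \<open>m\<close>.
  Only the derivatives in the directions \<open>x\<^sub>1\<close> and \<open>x\<^sub>2\<close> enter, since the operation \<open>*\<close> discards the
  scalar part. In Cartesian coordinates a solid harmonic is
  \<open>(-1)\<^sup>m \<rho>\<^bsup>n-m\<^esup> P\<^sub>n\<^bsup>(m)\<^esup>(x\<^sub>0/\<rho>)\<close> times the real or imaginary part of \<open>(x\<^sub>1 + \<i> x\<^sub>2)\<^sup>m\<close>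
  (\<open>U_cartesian\<close>). Differentiating the radial factor multiplies by \<open>x\<^sub>1\<close> or \<open>x\<^sub>2\<close> and so moves the order to
  \<open>m \<plusminus> 1\<close>, differentiating the angular factor lowers it to \<open>m - 1\<close> (\<open>partial_U\<close>).
  What remains is to compare Legendre coefficients of degrees \<open>n\<close> and \<open>-n\<close>.

  With \<open>P\<^bsub>-n\<^esub> = P\<^bsub>n-1\<^esub>\<close> these two degrees denote neighbouring Legendre polynomials, and they are related
  by \<open>P\<^sub>n' = n P\<^bsub>-n\<^esub> + t P\<^bsub>-n\<^esub>'\<close> for every integer \<open>n\<close> (\<open>pderiv_Legendre_int\<close>). Its derivatives
  match the terms of order \<open>m + 1\<close> directly (\<open>Legendre_deriv_reflect\<close>) and, combined among
  themselves, the terms of order \<open>m - 1\<close> with their coefficient \<open>\<alpha>\<close> (\<open>Legendre_deriv_three_term\<close>).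
\<close>

section \<open>Legendre polynomials of integer degree\<close>

text \<open>
  Leibniz' rule for a linear factor. At \<open>k = 0\<close> the truncated exponent \<open>k - 1\<close> is harmless because
  of the coefficient \<open>k\<close>.
\<close>
lemma higher_pderiv_times_X:
  fixes q :: "real poly"
  shows "(pderiv ^^ k) ([:0, 1:] * q) = [:0, 1:] * (pderiv ^^ k) q + of_nat k * (pderiv ^^ (k - 1)) q"
proof (induction k)
  case (Suc k)
  show ?case
    by (cases k) (use Suc in \<open>simp_all add: pderiv_add pderiv_mult pderiv_pCons algebra_simps\<close>)
qed simp

text \<open>
  In the Rodrigues formula put \<open>w = t\<^sup>2 - 1\<close>, \<open>A = D\<^sup>k w\<^sup>k\<close> and \<open>B = D\<^bsup>k+1\<^esup> w\<^bsup>k+1\<^esup>\<close>.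
  Since \<open>D w\<^bsup>k+1\<^esup> = 2 (k + 1) t w\<^sup>k\<close>, Leibniz' rule expresses both \<open>B\<close> and \<open>D B\<close> by \<open>w\<^sup>k\<close>,
  and the latter is the first recurrence. Expanding \<open>B\<close> a second time, from \<open>w\<^bsup>k+1\<^esup> = w w\<^sup>k\<close>, gives
  an independent relation. Eliminating \<open>D\<^bsup>k-1\<^esup> w\<^sup>k\<close> between the two expansions of \<open>B\<close> leaves the
  second recurrence.
\<close>
lemma Legendre_poly_derivative_recurrences:
  defines "P \<equiv> Legendre_poly"
  shows "pderiv (P (Suc k)) = [:0, 1:] * pderiv (P k) + smult (real (Suc k)) (P k)"
    and "pderiv (P k) = [:0, 1:] * pderiv (P (Suc k)) - smult (real (Suc k)) (P (Suc k))"
proof -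
  define X :: "real poly" where "X = [:0, 1:]"
  define w :: "real poly" where "w = [:-1, 0, 1:]"
  define v where "v = w ^ k"
  define A where "A = (pderiv ^^ k) v"
  define B where "B = (pderiv ^^ Suc k) (w ^ Suc k)"
  define C where "C = (pderiv ^^ (k - 1)) v"
  define N :: "real poly" where "N = of_nat (Suc k)"
  define c :: real where "c = 1 / (2 ^ k * fact k)"
  have dv: "pderiv (w ^ Suc k) = smult (2 * real (Suc k)) (X * v)"
    unfolding v_def X_def w_def by (subst pderiv_power_Suc) (simp add: pderiv_pCons algebra_simps flip: smult_add_left)
  have N: "smult (real (Suc k)) p = N * p" for p
    by (simp add: N_def of_nat_poly del: of_nat_Suc)
  have N2: "smult (2 * real (Suc k)) p = 2 * N * p" for p
    unfolding mult_2 smult_add_left N by (simp add: distrib_right)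
  note leib = higher_pderiv_times_X[folded X_def]
  have A': "(pderiv ^^ Suc k) v = pderiv A"
    by (simp add: A_def)
  \<comment> \<open>Expansion of \<open>B\<close> from \<open>D w\<^bsup>k+1\<^esup> = 2 (k + 1) t w\<^sup>k\<close>.\<close>
  have B1: "B = 2 * N * (X * A + of_nat k * C)"
    unfolding B_def funpow_Suc_right o_def dv higher_pderiv_smult leib
    by (simp only: N2 A_def C_def)
  have B2: "pderiv B = 2 * N * (X * pderiv A + N * A)"
  proof -
    have "pderiv B = (pderiv ^^ Suc k) (pderiv (w ^ Suc k))"
      unfolding B_def by (simp only: funpow_swap1)
    also have "\<dots> = 2 * N * (X * pderiv A + N * A)"
      unfolding dv higher_pderiv_smult leib A' unfolding N2 by (simp add: N_def A_def)
    finally show ?thesis .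
  qed
  \<comment> \<open>Expansion of \<open>B\<close> from \<open>w\<^bsup>k+1\<^esup> = t (t w\<^sup>k) - w\<^sup>k\<close>.\<close>
  have B3: "B = X * (X * pderiv A + N * A) + N * (X * A + of_nat k * C) - pderiv A"
  proof -
    have "w = X * X + smult (-1) 1"
      by (simp add: X_def w_def)
    then have "w ^ Suc k = X * (X * v) + smult (-1) v"
      by (simp add: v_def algebra_simps)
    then have "B = (pderiv ^^ Suc k) (X * (X * v)) + smult (-1) ((pderiv ^^ Suc k) v)"
      unfolding B_def by (simp only: higher_pderiv_add higher_pderiv_smult)
    then show ?thesis
      unfolding leib A' diff_Suc_1 N_def[symmetric] by (simp add: A_def C_def)
  qed
  have Pk: "P k = smult c A"
    by (simp add: P_def Legendre_poly_def A_def v_def c_def w_def)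
  have PS: "smult (2 * real (Suc k)) (P (Suc k)) = smult c B"
    unfolding P_def Legendre_poly_def w_def[symmetric] B_def[symmetric] c_def smult_smult
    by (rule arg_cong[where f = "\<lambda>r. smult r B"]) (simp add: field_simps del: of_nat_Suc)
  have cancel: "p = q" if "smult (2 * real (Suc k)) p = smult (2 * real (Suc k)) q" for p q :: "real poly"
    using smult_cancel[of "2 * real (Suc k)" p q] that by simp
  have "smult (2 * real (Suc k)) (pderiv (P (Suc k))) = smult c (pderiv B)"
    by (metis PS pderiv_smult)
  also have "\<dots> = 2 * N * (X * smult c (pderiv A) + N * smult c A)"
    unfolding B2 by (simp only: mult_smult_right smult_add_right[symmetric])
  also have "\<dots> = smult (2 * real (Suc k)) (X * pderiv (P k) + smult (real (Suc k)) (P k))"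
    unfolding N2 N Pk pderiv_smult ..
  finally show "pderiv (P (Suc k)) = [:0, 1:] * pderiv (P k) + smult (real (Suc k)) (P k)"
    unfolding X_def[symmetric] by (rule cancel)
  have B4: "2 * N * pderiv A = X * pderiv B - N * B"
  proof -
    define Y where "Y = N * (X * A + of_nat k * C)"
    define W where "W = X * (X * pderiv A + N * A)"
    \<comment> \<open>In twice the second expansion minus the first, the term with \<open>C\<close> cancels.\<close>
    have "B = 2 * B - B" by simp
    also have "\<dots> = 2 * (W + Y - pderiv A) - 2 * Y"
      using B1 B3 unfolding W_def[symmetric] Y_def[symmetric] by (metis Y_def mult.assoc)
    finally have B: "B = 2 * W - 2 * pderiv A"
      by (simp add: algebra_simps)
    show ?thesis
      unfolding B2 by (subst B) (simp add: W_def algebra_simps)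
  qed
  have "smult (2 * real (Suc k)) (pderiv (P k)) = smult c (2 * N * pderiv A)"
    unfolding N2 Pk pderiv_smult by simp
  also have "\<dots> = X * pderiv (smult c B) - N * smult c B"
    unfolding B4 pderiv_smult by (simp add: smult_diff_right)
  also have "\<dots> = smult (2 * real (Suc k)) (X * pderiv (P (Suc k)) - smult (real (Suc k)) (P (Suc k)))"
    unfolding PS[symmetric] pderiv_smult N by (simp add: smult_diff_right)
  finally show "pderiv (P k) = [:0, 1:] * pderiv (P (Suc k)) - smult (real (Suc k)) (P (Suc k))"
    unfolding X_def[symmetric] by (rule cancel)
qed

text \<open>
  The convention \<open>P\<^bsub>-n\<^esub> = P\<^bsub>n-1\<^esub>\<close> built into \<open>assoc_Legendre\<close>. The reflection \<open>n \<mapsto> -n\<close> exchanges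
  the neighbouring polynomials \<open>P\<^bsub>k+1\<^esub>\<close> (at \<open>n = k + 1\<close>) and \<open>P\<^sub>k\<close> (at \<open>n = -(k + 1)\<close>).
\<close>
definition Legendre_int :: "int \<Rightarrow> real poly" where
  "Legendre_int n = Legendre_poly (nat (if n \<ge> 0 then n else - n - 1))"

lemma Legendre_int_of_nat: "Legendre_int (int k) = Legendre_poly k"
  and Legendre_int_minus_Suc: "Legendre_int (- int (Suc k)) = Legendre_poly k"
  by (simp_all add: Legendre_int_def)

text \<open>
  The two classical recurrences are the cases \<open>n = k + 1\<close> and \<open>n = -(k + 1)\<close> of a single identity.
  Hence one computation covers the interior and the exterior case of the theorem.
\<close>
lemma pderiv_Legendre_int:
  "pderiv (Legendre_int n) =
     smult (of_int n) (Legendre_int (- n)) + [:0, 1:] * pderiv (Legendre_int (- n))"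
proof -
  consider "n = 0" | k where "n = int (Suc k)" | k where "n = - int (Suc k)"
    by (metis int_cases not0_implies_Suc of_nat_0)
  then show ?thesis
  proof cases
    case 1
    then show ?thesis by (simp add: Legendre_int_def Legendre_poly_def)
  next
    case (2 k)
    show ?thesis
      unfolding 2 Legendre_int_of_nat Legendre_int_minus_Suc
        Legendre_poly_derivative_recurrences(1)[of k] by simp
  next
    case (3 k)
    show ?thesis
      unfolding 3 minus_minus Legendre_int_of_nat Legendre_int_minus_Suc
      by (subst Legendre_poly_derivative_recurrences(2)) (simp del: of_nat_Suc)
  qed
qed

definition Legendre_deriv :: "nat \<Rightarrow> int \<Rightarrow> real \<Rightarrow> real" where
  "Legendre_deriv m n t = poly ((pderiv ^^ m) (Legendre_int n)) t"

text \<open>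
  The \<open>m\<close>-th derivative of the preceding identity. It says that differentiating the radial factor of
  a solid harmonic of degree \<open>-n\<close> along an equatorial axis produces the Legendre function of degree
  \<open>n\<close> and order \<open>m + 1\<close>.
\<close>
lemma Legendre_deriv_reflect:
  "Legendre_deriv (Suc m) n t =
     (of_int n + real m) * Legendre_deriv m (- n) t + t * Legendre_deriv (Suc m) (- n) t"
proof -
  have "(pderiv ^^ Suc m) (Legendre_int n) = (pderiv ^^ m) (pderiv (Legendre_int n))"
    by (simp only: funpow_Suc_right o_def)
  also have "\<dots> = smult (of_int n) ((pderiv ^^ m) (Legendre_int (- n)))
      + ([:0, 1:] * (pderiv ^^ m) (pderiv (Legendre_int (- n)))
         + of_nat m * (pderiv ^^ (m - 1)) (pderiv (Legendre_int (- n))))"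
    by (simp only: pderiv_Legendre_int[of n] higher_pderiv_add higher_pderiv_smult higher_pderiv_times_X)
  also have "of_nat m * (pderiv ^^ (m - 1)) (pderiv (Legendre_int (- n)))
      = of_nat m * (pderiv ^^ m) (Legendre_int (- n))"
    by (cases m) (simp_all add: funpow_swap1)
  finally show ?thesis
    by (simp add: Legendre_deriv_def funpow_swap1 of_nat_poly algebra_simps)
qed

text \<open>
  This is where the coefficient \<open>\<alpha>\<close> comes from: with \<open>m - 1\<close> for \<open>m\<close>, the right-hand factor
  is \<open>(n - m) (n - m + 1)\<close>. The identity follows by using reflection at \<open>n\<close>, at \<open>-n\<close>,
  and at \<open>-n\<close> one order lower, to eliminate \<open>P\<^bsub>-n\<^esub>\<^bsup>(m+2)\<^esup>\<close> and \<open>P\<^sub>n\<^bsup>(m+1)\<^esup>\<close>.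
\<close>
lemma Legendre_deriv_three_term:
  "2 * real (Suc m) * Legendre_deriv (Suc m) (- n) t - (1 - t\<^sup>2) * Legendre_deriv (Suc (Suc m)) n t
     = (of_int n - real m - 1) * (of_int n - real m) * Legendre_deriv m n t"
proof -
  define N where "N = real_of_int n"
  define a b c where "a = Legendre_deriv m n t" and "b = Legendre_deriv (Suc m) n t"
    and "c = Legendre_deriv (Suc (Suc m)) n t"
  define l l' where "l = Legendre_deriv (Suc m) (- n) t" and "l' = Legendre_deriv (Suc (Suc m)) (- n) t"
  have c: "c = (N + real m + 1) * l + t * l'"
    using Legendre_deriv_reflect[of "Suc m" n t] by (simp add: N_def c_def l_def l'_def algebra_simps)
  have l': "l' = (real m + 1 - N) * b + t * c"
    using Legendre_deriv_reflect[of "Suc m" "- n" t] by (simp add: N_def b_def c_def l'_def algebra_simps)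
  have tb: "t * b = l - (real m - N) * a"
    using Legendre_deriv_reflect[of m "- n" t] by (simp add: N_def a_def b_def l_def algebra_simps)
  have "(1 - t\<^sup>2) * c = (N + real m + 1) * l + t * (l' - t * c)"
    using c by (simp add: power2_eq_square algebra_simps)
  also have "l' - t * c = (real m + 1 - N) * b"
    using l' by simp
  also have "t * ((real m + 1 - N) * b) = (real m + 1 - N) * (l - (real m - N) * a)"
    unfolding tb[symmetric] by simp
  finally have "2 * real (Suc m) * l - (1 - t\<^sup>2) * c = (N - real m - 1) * (N - real m) * a"
    by (simp add: algebra_simps)
  then show ?thesis
    by (simp only: N_def a_def c_def l_def)
qed

section \<open>Solid harmonics in Cartesian coordinates\<close>

text \<open>
  The superscript \<open>\<plusminus>\<close> of a harmonic selects the real or the imaginary part of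
  \<open>(x\<^sub>1 + \<i> x\<^sub>2)\<^sup>m\<close>.
\<close>
definition part :: "pm \<Rightarrow> complex \<Rightarrow> real" where
  "part s z = (case s of Plus \<Rightarrow> Re z | Minus \<Rightarrow> Im z)"

definition horiz :: "real ^ 3 \<Rightarrow> complex" where
  "horiz x = Complex (x $ 1) (x $ 2)"

lemma norm_power2_vec3: "(norm x)\<^sup>2 = (x $ 0)\<^sup>2 + (cmod (horiz x))\<^sup>2" for x :: "real ^ 3"
proof -
  have three: "(3 :: 3) = 0" by simp
  have "(norm x)\<^sup>2 = (\<Sum>i\<in>UNIV. (x $ i)\<^sup>2)"
    unfolding power2_norm_eq_inner by (simp add: inner_vec_def power2_eq_square)
  also have "\<dots> = (x $ 1)\<^sup>2 + (x $ 2)\<^sup>2 + (x $ 0)\<^sup>2"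
    unfolding sum_3 three by simp
  finally show ?thesis
    by (simp add: horiz_def cmod_power2)
qed

lemma one_minus_cos_polar_angle_power2:
  fixes x :: "real ^ 3"
  assumes "x \<noteq> 0"
  shows "1 - (x $ 0 / norm x)\<^sup>2 = (cmod (horiz x) / norm x)\<^sup>2"
  unfolding power_divide using assms norm_power2_vec3[of x]
  by (metis add_diff_cancel_left' diff_divide_distrib divide_self norm_eq_zero power_not_zero)

lemma part_power_polar: "part s (z ^ m) = cmod z ^ m * \<Phi> m s (Arg z)"
proof -
  have "z ^ m = rcis (cmod z ^ m) (real m * Arg z)"
    by (metis DeMoivre2 rcis_cmod_Arg)
  then show ?thesis
    by (cases s) (simp_all add: part_def)
qed

text \<open>
  Because \<open>sin \<theta> = \<bar>x\<^sub>1 + \<i> x\<^sub>2\<bar> / \<rho>\<close>, the factor \<open>sin\<^sup>m \<theta>\<close> of the associated Legendre function and the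
  azimuthal factor combine to \<open>(x\<^sub>1 + \<i> x\<^sub>2)\<^sup>m / \<rho>\<^sup>m\<close>. The angles disappear, and the resulting
  expression is visibly smooth away from the origin, including the polar axis where the azimuth is
  singular.
\<close>
lemma U_cartesian:
  assumes "x \<noteq> 0"
  shows "U n m s x = (-1) ^ m * (norm x powi (n - int m) * Legendre_deriv m n (x $ 0 / norm x))
           * part s (horiz x ^ m)"
proof -
  have "sqrt (1 - (x $ 0 / norm x)\<^sup>2) = cmod (horiz x) / norm x"
    by (simp add: one_minus_cos_polar_angle_power2[OF assms])
  then show ?thesis
    using assms
    by (simp add: U_def assoc_Legendre_def Legendre_deriv_def Legendre_int_def part_power_polar
        power_int_diff power_divide flip: horiz_def)
qed

section \<open>Equatorial derivatives of solid harmonics\<close>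

lemma norm_axis_line_deriv:
  fixes x :: "real ^ 3"
  assumes "x \<noteq> 0"
  shows "((\<lambda>t. norm (x + t *\<^sub>R axis i 1)) has_field_derivative x $ i / norm x) (at 0)"
proof -
  have "((\<lambda>t. x + t *\<^sub>R axis i 1) has_derivative (\<lambda>h. h *\<^sub>R axis i 1)) (at (0 :: real))"
    by (auto intro!: derivative_eq_intros)
  then have "((\<lambda>t. norm (x + t *\<^sub>R axis i 1)) has_derivative
      (\<lambda>h. (h *\<^sub>R axis i 1) \<bullet> sgn x)) (at (0 :: real))"
    using has_derivative_compose[where g = norm and g' = "\<lambda>h. h \<bullet> sgn x"] has_derivative_norm[OF assms]
    by fastforce
  moreover have "(\<lambda>h. (h *\<^sub>R axis i 1) \<bullet> sgn x) = (*) (x $ i / norm x)"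
    by (auto simp: fun_eq_iff inner_axis' sgn_div_norm divide_inverse)
  ultimately show ?thesis
    by (simp add: has_field_derivative_def)
qed

lemma part_power_line_deriv:
  "((\<lambda>t. part s ((w + of_real t * u) ^ m)) has_field_derivative
      part s (of_nat m * u * w ^ (m - 1))) (at 0)"
proof -
  have "((\<lambda>z. (w + z * u) ^ m) has_field_derivative of_nat m * u * w ^ (m - 1)) (at (of_real 0))"
    by (auto intro!: derivative_eq_intros)
  then have "((\<lambda>t. (w + of_real t * u) ^ m) has_vector_derivative of_nat m * u * w ^ (m - 1)) (at 0)"
    by (rule has_vector_derivative_real_field)
  moreover have "bounded_linear (part s)"
    unfolding part_def by (cases s) (simp_all add: bounded_linear_Re bounded_linear_Im)
  ultimately show ?thesis
    unfolding has_real_derivative_iff_has_vector_derivative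
    by (rule bounded_linear.has_vector_derivative[rotated])
qed

lemma Legendre_deriv_has_derivative:
  "(Legendre_deriv m n has_field_derivative Legendre_deriv (Suc m) n t) (at t)"
  unfolding Legendre_deriv_def by (auto intro!: derivative_eq_intros)

text \<open>
  The radial factor \<open>\<rho>\<^bsup>n-m\<^esup> P\<^sub>n\<^bsup>(m)\<^esup>(x\<^sub>0/\<rho>)\<close> depends on \<open>x\<^sub>1\<close> and \<open>x\<^sub>2\<close> only through \<open>\<rho>\<close>, so its
  derivative along either axis is \<open>x\<^sub>i\<close> times a common function, which the reflection identity
  at \<open>-n\<close> collapses to one Legendre derivative of degree \<open>-n\<close>. The other term of the product
  rule differentiates \<open>(x\<^sub>1 + \<i> x\<^sub>2)\<^sup>m\<close> in the complex direction \<open>1\<close> or \<open>\<i>\<close>.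
\<close>
lemma partial_U:
  fixes x :: "real ^ 3"
  assumes "x \<noteq> 0" "i \<noteq> 0"
  shows "partial i (U n m s) x = (-1) ^ m *
     (norm x powi (n - int m) * Legendre_deriv m n (x $ 0 / norm x)
         * part s (of_nat m * horiz (axis i 1) * horiz x ^ (m - 1))
      - x $ i * norm x powi (n - int m - 2) * Legendre_deriv (Suc m) (- n) (x $ 0 / norm x)
         * part s (horiz x ^ m))"
proof -
  define r where "r = norm x"
  define \<gamma> where "\<gamma> t = x + t *\<^sub>R axis i 1" for t
  have r: "r > 0" using assms by (simp add: r_def)
  have \<gamma>0: "\<gamma> t $ 0 = x $ 0" for t
    using assms by (simp add: \<gamma>_def axis_def)
  have dr: "((\<lambda>t. norm (\<gamma> t)) has_field_derivative x $ i / r) (at 0)"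
    unfolding \<gamma>_def r_def by (rule norm_axis_line_deriv[OF assms(1)])
  have [simp]: "\<gamma> 0 = x" by (simp add: \<gamma>_def)
  have "((\<lambda>t. \<gamma> t $ 0 / norm (\<gamma> t)) has_field_derivative - (x $ 0 * x $ i / r ^ 3)) (at 0)"
    unfolding \<gamma>0 by (rule derivative_eq_intros dr refl | use r in \<open>simp add: r_def power3_eq_cube field_simps\<close>)+
  from DERIV_chain2[OF Legendre_deriv_has_derivative this, of m n]
  have dL: "((\<lambda>t. Legendre_deriv m n (\<gamma> t $ 0 / norm (\<gamma> t))) has_field_derivative
      Legendre_deriv (Suc m) n (x $ 0 / r) * - (x $ 0 * x $ i / r ^ 3)) (at 0)"
    by (simp add: r_def)
  have dp: "((\<lambda>t. norm (\<gamma> t) powi (n - int m)) has_field_derivative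
      (of_int n - real m) * r powi (n - int m - 1) * (x $ i / r)) (at 0)"
    using DERIV_power_int[OF dr, of "n - int m"] r by (simp add: r_def)
  define E where "E = r powi (n - int m - 2)"
  have e: "r powi (n - int m) = E * r\<^sup>2" "r powi (n - int m - 1) = E * r"
    unfolding E_def using r power_int_add[of r "n - int m - 2" 2] power_int_add[of r "n - int m - 2" 1] by simp_all
  \<comment> \<open>Reflection at \<open>-n\<close> merges the derivatives of the two factors.\<close>
  have radial: "((\<lambda>t. norm (\<gamma> t) powi (n - int m) * Legendre_deriv m n (\<gamma> t $ 0 / norm (\<gamma> t)))
      has_field_derivative - (x $ i * r powi (n - int m - 2) * Legendre_deriv (Suc m) (- n) (x $ 0 / r))) (at 0)"
    by (rule DERIV_cong[OF DERIV_mult[OF dp dL]])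
      (unfold r_def[symmetric] \<open>\<gamma> 0 = x\<close> e E_def[symmetric] Legendre_deriv_reflect[of m "- n"],
        use r in \<open>simp add: power2_eq_square power3_eq_cube field_simps\<close>)
  have "horiz (\<gamma> t) = horiz x + of_real t * horiz (axis i 1)" for t
    by (simp add: horiz_def \<gamma>_def complex_eq_iff)
  then have ang: "((\<lambda>t. part s (horiz (\<gamma> t) ^ m)) has_field_derivative
      part s (of_nat m * horiz (axis i 1) * horiz x ^ (m - 1))) (at 0)"
    using part_power_line_deriv by simp
  have "((\<lambda>t. (-1) ^ m * (norm (\<gamma> t) powi (n - int m) * Legendre_deriv m n (\<gamma> t $ 0 / norm (\<gamma> t)))
            * part s (horiz (\<gamma> t) ^ m)) has_field_derivative (-1) ^ m *
     (r powi (n - int m) * Legendre_deriv m n (x $ 0 / r)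
         * part s (of_nat m * horiz (axis i 1) * horiz x ^ (m - 1))
      - x $ i * r powi (n - int m - 2) * Legendre_deriv (Suc m) (- n) (x $ 0 / r)
         * part s (horiz x ^ m))) (at 0)" (is "(?f has_field_derivative ?D) _")
    unfolding mult.assoc[of "(-1) ^ m"]
    by (rule DERIV_cong[OF DERIV_cmult[OF DERIV_mult[OF radial ang]]])
      (simp add: r_def algebra_simps)
  moreover have "\<forall>\<^sub>F t in nhds 0. \<gamma> t \<noteq> 0"
  proof -
    have "isCont \<gamma> 0" unfolding \<gamma>_def by (intro continuous_intros)
    then have "\<forall>\<^sub>F t in at 0. \<gamma> t \<noteq> 0"
      unfolding isCont_def by (rule tendsto_imp_eventually_ne) (simp add: assms)
    then show ?thesis by (simp add: eventually_nhds_conv_at assms)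
  qed
  then have "\<forall>\<^sub>F t in nhds 0. U n m s (\<gamma> t) = ?f t"
    by eventually_elim (rule U_cartesian)
  ultimately have "((\<lambda>t. U n m s (\<gamma> t)) has_field_derivative ?D) (at 0)"
    by (subst DERIV_cong_ev[OF refl _ refl])
  then show ?thesis
    unfolding partial_def \<gamma>_def r_def by (rule DERIV_imp_deriv)
qed

section \<open>Contragenic functions as images of monogenic functions\<close>

lemma star_X:
  "star (X n m s x) = partial 1 (U (n + 1) m s) x *\<^sub>R e2 - partial 2 (U (n + 1) m s) x *\<^sub>R e1"
  by (simp add: star_def X_def del_def quat_eq_iff e1_def e2_def of_real_def)

lemma horiz_axis [simp]: "horiz (axis 1 1) = 1" "horiz (axis 2 1) = \<i>"
  by (simp_all add: horiz_def axis_def complex_eq_iff)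

lemma Z_eq_star_X_zero:
  assumes "x \<noteq> 0"
  shows "Z n 0 Plus x = - ((norm x powi (2 * n + 1)) *\<^sub>R star (X (- n - 1) 0 Plus x))"
proof -
  define r where "r = norm x"
  define D where "D = Legendre_deriv (Suc 0) n (x $ 0 / r)"
  have r: "r > 0" using assms by (simp add: r_def)
  have U1: "U n 1 s x = - (r powi (n - 1) * D * part s (horiz x))" for s
    using U_cartesian[OF assms, of n 1 s] by (simp add: r_def D_def)
  have P: "r powi (2 * n + 1) * partial i (U (- n) 0 Plus) x = - (r powi (n - 1) * D * x $ i)"
    if "i \<noteq> 0" for i
  proof -
    have "r powi (n - 1) = r powi (2 * n + 1) * r powi (- n - 2)"
      using r by (simp flip: power_int_add)
    then show ?thesis
      using partial_U[OF assms that, of "- n" 0 Plus] by (simp add: r_def D_def part_def)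
  qed
  show ?thesis
    using P[of 1] P[of 2]
    by (simp add: Z_def star_X U1[unfolded One_nat_def] quat_eq_iff e1_def e2_def part_def horiz_def flip: r_def)
qed

text \<open>
  With \<open>w = x\<^sub>1 + \<i> x\<^sub>2\<close>, both sides are combinations of the real and imaginary parts of \<open>w\<^bsup>m+1\<^esup>\<close> and
  \<open>w\<^bsup>m-1\<^esup>\<close>: on the right these arise from splitting \<open>x\<^sub>i w\<^sup>m\<close> by means of \<open>2 x\<^sub>1 = w + cnj w\<close> and
  \<open>2 \<i> x\<^sub>2 = w - cnj w\<close>, since \<open>cnj w w\<^sup>m = \<bar>w\<bar>\<^sup>2 w\<^bsup>m-1\<^esup>\<close>. The coefficients of \<open>w\<^bsup>m+1\<^esup>\<close>
  agree by the formula for the derivative, and those of \<open>w\<^bsup>m-1\<^esup>\<close> by the three-term relation.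
\<close>
lemma Z_eq_star_X_Suc:
  assumes "x \<noteq> 0" "m = Suc k"
  shows "Z n m s x = - ((pm_sign s * 2 * norm x powi (2 * n + 1)) *\<^sub>R star (X (- n - 1) m s x))"
proof -
  define r where "r = norm x"
  define w where "w = horiz x"
  \<comment> \<open>Up to the common factor \<open>E\<close>, both sides are linear in the two values \<open>H\<close> (degree \<open>n\<close>, order \<open>m + 1\<close>)
    and \<open>L\<close> (degree \<open>-n\<close>, order \<open>m\<close>).\<close>
  define E where "E = (-1) ^ m * r powi (n - int m - 1)"
  define H where "H = Legendre_deriv (Suc m) n (x $ 0 / r)"
  define L where "L = real m * r\<^sup>2 * Legendre_deriv m (- n) (x $ 0 / r)"
  define R where "R = r powi (2 * n + 1)"
  have r: "r > 0" using assms by (simp add: r_def)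
  have up: "U n (m + 1) s' x = - (E * (H * part s' (w * w * w ^ k)))" for s'
    using U_cartesian[OF assms(1), of n "m + 1" s'] assms(2)
    by (simp add: r_def E_def H_def w_def algebra_simps)
  have down: "\<alpha> n (- int m) * U n (m - 1) s' x = - (E * ((2 * L - (cmod w)\<^sup>2 * H) * part s' (w ^ k)))" for s'
  proof -
    have sin: "r\<^sup>2 * (1 - (x $ 0 / r)\<^sup>2) = (cmod w)\<^sup>2"
      unfolding r_def w_def
      by (subst one_minus_cos_polar_angle_power2[OF assms(1)]) (simp add: power_divide assms(1))
    have "2 * L - (cmod w)\<^sup>2 * H =
        r\<^sup>2 * (2 * real m * Legendre_deriv m (- n) (x $ 0 / r) - (1 - (x $ 0 / r)\<^sup>2) * H)"
      unfolding L_def sin[symmetric] by (simp add: algebra_simps)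
    also have "\<dots> = r\<^sup>2 * ((of_int n - real m) * (of_int n - real k) * Legendre_deriv k n (x $ 0 / r))"
      using Legendre_deriv_three_term[of k n "x $ 0 / r"] unfolding H_def assms(2) by simp
    finally have *: "2 * L - (cmod w)\<^sup>2 * H = r\<^sup>2 * (\<alpha> n (- int m) * Legendre_deriv k n (x $ 0 / r))"
      using assms(2) by (simp add: \<alpha>_def)
    have "U n k s' x = - ((-1) ^ m * (r powi (n - int k) * Legendre_deriv k n (x $ 0 / r)) * part s' (w ^ k))"
      using U_cartesian[OF assms(1), of n k s'] assms(2) by (simp add: r_def w_def)
    moreover have "r powi (n - int k) = r powi (n - int m - 1) * r\<^sup>2"
      using r power_int_add[of r "n - int m - 1" 2] assms(2) by simp
    ultimately show ?thesis
      unfolding * E_def by (simp add: assms(2))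
  qed
  have P: "R * partial i (U (- n) m s) x =
      E * (L * part s (horiz (axis i 1) * w ^ k) - x $ i * H * part s (w * w ^ k))" if "i \<noteq> 0" for i
  proof -
    define F where "F = r powi (- n - int m - 2)"
    have F: "r powi (- n - int m) = F * r\<^sup>2"
      unfolding F_def using r power_int_add[of r "- n - int m - 2" 2] by simp
    have scale: "part s (of_nat m * z) = real m * part s z" for z
      by (cases s) (simp_all add: part_def)
    have "partial i (U (- n) m s) x = (-1) ^ m *
        (r powi (- n - int m) * Legendre_deriv m (- n) (x $ 0 / r) * part s (of_nat m * (horiz (axis i 1) * w ^ k))
         - x $ i * F * H * part s (w * w ^ k))"
      using partial_U[OF assms(1) that, of "- n" m s] unfolding F_def H_def r_def w_def
      by (simp only: minus_minus assms(2) diff_Suc_1 power_Suc mult.assoc)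
    also have "\<dots> = (-1) ^ m * F * (L * part s (horiz (axis i 1) * w ^ k) - x $ i * H * part s (w * w ^ k))"
      unfolding scale F L_def by (simp add: algebra_simps)
    finally have "partial i (U (- n) m s) x =
        (-1) ^ m * F * (L * part s (horiz (axis i 1) * w ^ k) - x $ i * H * part s (w * w ^ k))" .
    moreover have "r powi (n - int m - 1) = R * F"
      unfolding R_def F_def using r by (simp add: algebra_simps flip: power_int_add)
    ultimately show ?thesis
      by (simp add: E_def)
  qed
  define c d where "c = Re (w ^ k)" and "d = Im (w ^ k)"
  define p q where "p = x $ 1" and "q = x $ 2"
  have w: "w = Complex p q" and wk: "w ^ k = Complex c d"
    by (simp_all add: w_def horiz_def p_def q_def c_def d_def)
  have ww: "w * w ^ k = Complex (p * c - q * d) (p * d + q * c)"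
    unfolding wk unfolding w by (simp add: complex_eq_iff)
  have www: "w * w * w ^ k = Complex (p * (p * c - q * d) - q * (p * d + q * c)) (p * (p * d + q * c) + q * (p * c - q * d))"
    unfolding mult.assoc ww unfolding w by (simp add: complex_eq_iff)
  have iw: "\<i> * w ^ k = Complex (- d) c"
    unfolding wk by (simp add: complex_eq_iff)
  have norm_w: "(cmod w)\<^sup>2 = p * p + q * q"
    unfolding w cmod_power2 by (simp add: power2_eq_square)
  have P1: "R * partial 1 (U (- n) m s) x = E * (L * part s (Complex c d) - p * H * part s (w * w ^ k))"
    using P[of 1] by (simp add: wk p_def)
  have P2: "R * partial 2 (U (- n) m s) x = E * (L * part s (Complex (- d) c) - q * H * part s (w * w ^ k))"
    using P[of 2] by (simp add: iw q_def)
  have "m \<noteq> 0" using assms(2) by simp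
  then have Z1: "Q1 (Z n m s x) = U n (m + 1) (flip s) x + \<alpha> n (- int m) * U n (m - 1) (flip s) x"
    and Z2: "Q2 (Z n m s x) = - (pm_sign s * (U n (m + 1) s x - \<alpha> n (- int m) * U n (m - 1) s x))"
    by (simp_all add: Z_def e1_def e2_def)
  have "Q1 (Z n m s x) = pm_sign s * 2 * (R * partial 2 (U (- n) m s) x)"
    unfolding Z1 up down P2 www ww norm_w unfolding wk part_def
    by (cases s; simp only: flip.simps pm_sign.simps pm.case complex.sel; simp add: algebra_simps)
  moreover have "Q2 (Z n m s x) = - (pm_sign s * 2 * (R * partial 1 (U (- n) m s) x))"
    unfolding Z2 up down P1 www ww norm_w unfolding wk part_def
    by (cases s; simp only: flip.simps pm_sign.simps pm.case complex.sel; simp add: algebra_simps)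
  moreover have "Q0 (Z n m s x) = 0" "Q3 (Z n m s x) = 0"
    using assms(2) by (simp_all add: Z_def e1_def e2_def)
  ultimately show ?thesis
    by (simp add: star_X quat_eq_iff e1_def e2_def R_def r_def)
qed

theorem proposition8:
  fixes \<sigma> :: side and n :: int and m :: nat and s :: pm and x :: "real ^ 3"
  assumes "n \<in> J \<sigma> - {0}"
    and "m \<in> (if n > 0 then I_N Interior n else I_N Exterior (n + 1))"
    and "x \<noteq> 0"
  shows "(m = 0 \<longrightarrow>
            Z n 0 Plus x = - ((norm x powi (2 * n + 1)) *\<^sub>R star (X (- n - 1) 0 Plus x))) \<and>
         (m \<ge> 1 \<longrightarrow>
            Z n m s x = - ((pm_sign s * 2 * norm x powi (2 * n + 1)) *\<^sub>R star (X (- n - 1) m s x)))"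
  using Z_eq_star_X_zero[OF assms(3)] Z_eq_star_X_Suc[OF assms(3), of m "m - 1"] by simp

end
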